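(* Let $X,Y$ be complex Banach spaces and let $A\in\mathcal{L}(X,Y)$ and $B,C\in\mathcal{L}(Y,X)$ be such that $A(BA)^2=ABACA=ACABA=(AC)^2A$. Then $$\sigma_\beta(AC)=\sigma_\beta(BA).$$ In particular, $AC$ satisfies Bishop's property $(\beta)$ if and only if $BA$ satisfies Bishop's property $(\beta)$.
   Context: $\mathcal{L}(X,Y)$ is the set of bounded linear operators from $X$ to $Y$, and $\mathcal{L}(X)=\mathcal{L}(X,X)$. For an open set $V\subseteq\mathbb{C}$, $\mathcal{O}(V,X)$ is the Fréchet space of $X$-valued analytic functions on $V$ with the topology of uniform convergence on compact subsets of $V$. An operator $T\in\mathcal{L}(X)$ satisfies Bishop's property $(\beta)$ on an open set $U\subseteq\mathbb{C}$ if for every open subset $V$ of $U$ and every sequence $(f_n)_n$ in $\mathcal{O}(V,X)$: if $(T-\mu)f_n(\mu)\to 0$ in $\mathcal{O}(V,X)$ then $f_n(\mu)\to 0$ in $\mathcal{O}(V,X)$. $\rho_\beta(T)$ is the largest open set on which $T$ has property $(\beta)$, and $\sigma_\beta(T)=\mathbb{C}\setminus\rho_\beta(T)$. $T$ satisfies Bishop's property $(\beta)$ if $\sigma_\beta(T)=\emptyset$. *)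

theory Defs
  imports "HOL-Analysis.Analysis"
begin

text \<open>
  The distribution has no class of complex Banach spaces. The class below adds to a real normed
  space a complex scalar multiplication that extends the real one; \<open>scaleC 1 x = x\<close> is then
  derivable.
\<close>

class complex_normed_vector = real_normed_vector +
  fixes scaleC :: "complex \<Rightarrow> 'a \<Rightarrow> 'a" (infixr "*\<^sub>C" 75)
  assumes scaleC_add_right: "c *\<^sub>C (x + y) = c *\<^sub>C x + c *\<^sub>C y"
    and scaleC_add_left: "(c + d) *\<^sub>C x = c *\<^sub>C x + d *\<^sub>C x"
    and scaleC_scaleC: "c *\<^sub>C d *\<^sub>C x = (c * d) *\<^sub>C x"
    and scaleC_complex_of_real: "complex_of_real r *\<^sub>C x = r *\<^sub>R x"
    and norm_scaleC: "norm (c *\<^sub>C x) = cmod c * norm x"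

class complex_banach = complex_normed_vector + banach

instantiation complex :: complex_banach
begin

definition scaleC_complex_def: "c *\<^sub>C (x :: complex) = c * x"

instance
  by standard (simp_all add: scaleC_complex_def algebra_simps norm_mult scaleR_conv_of_real)

end

definition bounded_clinear ::
    "('a::complex_normed_vector \<Rightarrow> 'b::complex_normed_vector) \<Rightarrow> bool" where
  "bounded_clinear T \<longleftrightarrow> bounded_linear T \<and> (\<forall>c x. T (c *\<^sub>C x) = c *\<^sub>C T x)"

text \<open>
  The space \<open>\<O>(V, X)\<close> for open \<open>V\<close>: functions that are complex differentiable at every
  point of \<open>V\<close>. Functions are total, and their values outside \<open>V\<close> are irrelevant.
\<close>

definition analytic_space :: "complex set \<Rightarrow> (complex \<Rightarrow> 'a::complex_normed_vector) set" where
  "analytic_space V = {f. \<forall>z\<in>V. \<exists>D. (f has_derivative (\<lambda>h. h *\<^sub>C D)) (at z)}"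

lemma analytic_space_complex_iff:
  fixes f :: "complex \<Rightarrow> complex"
  assumes "open V"
  shows "f \<in> analytic_space V \<longleftrightarrow> f holomorphic_on V"
proof -
  have "(\<exists>D. (f has_derivative (\<lambda>h. h *\<^sub>C D)) (at z)) \<longleftrightarrow> f field_differentiable (at z)" for z
    unfolding field_differentiable_def has_field_derivative_def scaleC_complex_def
    by (simp only: mult.commute)
  then show ?thesis
    unfolding analytic_space_def holomorphic_on_open[OF assms] field_differentiable_def by simp
qed

definition converges_in_analytic_space ::
    "complex set \<Rightarrow> (nat \<Rightarrow> complex \<Rightarrow> 'a::complex_normed_vector) \<Rightarrow> (complex \<Rightarrow> 'a) \<Rightarrow> bool" where
  "converges_in_analytic_space V f g \<longleftrightarrow>
     (\<forall>K. compact K \<and> K \<subseteq> V \<longrightarrow> uniform_limit K f g sequentially)"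

definition bishop_beta_on ::
    "('a::complex_normed_vector \<Rightarrow> 'a) \<Rightarrow> complex set \<Rightarrow> bool" where
  "bishop_beta_on T U \<longleftrightarrow>
     (\<forall>V f. open V \<and> V \<subseteq> U \<and> (\<forall>n. f n \<in> analytic_space V) \<and>
        converges_in_analytic_space V (\<lambda>n \<mu>. T (f n \<mu>) - \<mu> *\<^sub>C f n \<mu>) (\<lambda>\<mu>. 0) \<longrightarrow>
        converges_in_analytic_space V f (\<lambda>\<mu>. 0))"

text \<open>\<open>Greatest\<close> is with respect to inclusion; the maximum exists by \<open>rho_beta_greatest\<close> below.\<close>

definition rho_beta :: "('a::complex_normed_vector \<Rightarrow> 'a) \<Rightarrow> complex set" where
  "rho_beta T = (GREATEST U. open U \<and> bishop_beta_on T U)"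

definition sigma_beta :: "('a::complex_normed_vector \<Rightarrow> 'a) \<Rightarrow> complex set" where
  "sigma_beta T = UNIV - rho_beta T"

definition bishop_beta :: "('a::complex_normed_vector \<Rightarrow> 'a) \<Rightarrow> bool" where
  "bishop_beta T \<longleftrightarrow> sigma_beta T = {}"

lemma bishop_beta_on_Union:
  assumes opn: "\<And>U. U \<in> \<U> \<Longrightarrow> open U" and beta: "\<And>U. U \<in> \<U> \<Longrightarrow> bishop_beta_on T U"
  shows "bishop_beta_on T (\<Union>\<U>)"
  unfolding bishop_beta_on_def
proof (intro allI impI, elim conjE)
  fix V f
  assume V: "open V" "V \<subseteq> \<Union>\<U>" and f: "\<forall>n. f n \<in> analytic_space V"
    and lim: "converges_in_analytic_space V (\<lambda>n \<mu>. T (f n \<mu>) - \<mu> *\<^sub>C f n \<mu>) (\<lambda>\<mu>. 0)"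
  have loc: "\<exists>e>0. uniform_limit (ball z e) f (\<lambda>\<mu>. 0) sequentially" if z: "z \<in> V" for z
  proof -
    obtain U where U: "U \<in> \<U>" "z \<in> U" using z V by blast
    have "open (V \<inter> U)" using V opn U by blast
    then obtain e where e: "e > 0" "cball z e \<subseteq> V \<inter> U"
      using z U(2) unfolding open_contains_cball by (meson IntI)
    have "\<forall>n. f n \<in> analytic_space (V \<inter> U)"
      using f by (simp add: analytic_space_def)
    moreover have "converges_in_analytic_space (V \<inter> U)
        (\<lambda>n \<mu>. T (f n \<mu>) - \<mu> *\<^sub>C f n \<mu>) (\<lambda>\<mu>. 0)"
      using lim unfolding converges_in_analytic_space_def by blast
    ultimately have "converges_in_analytic_space (V \<inter> U) f (\<lambda>\<mu>. 0)"
      using beta[OF U(1)] \<open>open (V \<inter> U)\<close> unfolding bishop_beta_on_def by blast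
    then have "uniform_limit (cball z e) f (\<lambda>\<mu>. 0) sequentially"
      using e unfolding converges_in_analytic_space_def by (meson compact_cball)
    then show ?thesis
      using e(1) uniform_limit_on_subset[OF _ ball_subset_cball] by metis
  qed
  show "converges_in_analytic_space V f (\<lambda>\<mu>. 0)"
    unfolding converges_in_analytic_space_def
  proof (intro allI impI, elim conjE)
    fix K assume K: "compact K" "K \<subseteq> V"
    from loc obtain e where e: "\<And>z. z \<in> V \<Longrightarrow> e z > 0"
      "\<And>z. z \<in> V \<Longrightarrow> uniform_limit (ball z (e z)) f (\<lambda>\<mu>. 0) sequentially"
      by metis
    obtain D where D: "D \<subseteq> K" "finite D" "K \<subseteq> (\<Union>z\<in>D. ball z (e z))"
    proof (rule compactE_image[OF K(1)])
      show "open (ball z (e z))" for z by simp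
      show "K \<subseteq> (\<Union>z\<in>K. ball z (e z))" using e(1) K(2) by force
    qed
    have "uniform_limit (\<Union>z\<in>D. ball z (e z)) f (\<lambda>\<mu>. 0) sequentially"
      using D(1,2) K(2) e(2) by (intro uniform_limit_on_UNION) auto
    then show "uniform_limit K f (\<lambda>\<mu>. 0) sequentially"
      by (rule uniform_limit_on_subset) (rule D(3))
  qed
qed

lemma rho_beta_eq_Union: "rho_beta T = \<Union>{U. open U \<and> bishop_beta_on T U}"
  unfolding rho_beta_def
  by (rule Greatest_equality) (auto intro: bishop_beta_on_Union)

lemma rho_beta_greatest:
  shows open_rho_beta: "open (rho_beta T)"
    and bishop_beta_on_rho_beta: "bishop_beta_on T (rho_beta T)"
    and subset_rho_beta: "open U \<Longrightarrow> bishop_beta_on T U \<Longrightarrow> U \<subseteq> rho_beta T"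
  unfolding rho_beta_eq_Union by (auto intro: bishop_beta_on_Union)

end

theory Submission
  imports Defs "HOL-Complex_Analysis.Conformal_Mappings"
begin

text \<open>
  Each of \<open>AC\<close> and \<open>BA\<close> is intertwined with the other by an operator that can be undone up to
  a power. Put
  \<open>R = BABAC\<close>; the relation \<open>ABABA = ABACA\<close> gives \<open>(BA)R = R(AC)\<close>, and \<open>ABABA = (AC)\<^sup>2A\<close> gives
  \<open>AR = (AC)\<^sup>3\<close>. If \<open>(AC - \<mu>)f\<^sub>n \<rightarrow> 0\<close>, then \<open>(BA - \<mu>)R f\<^sub>n = R(AC - \<mu>)f\<^sub>n \<rightarrow> 0\<close>, so property
  \<open>(\<beta>)\<close> of \<open>BA\<close> yields \<open>R f\<^sub>n \<rightarrow> 0\<close> and hence \<open>(AC)\<^sup>3 f\<^sub>n \<rightarrow> 0\<close>. Symmetrically, \<open>R' = ABA\<close>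
  satisfies \<open>(AC)R' = R'(BA)\<close> and \<open>BR' = (BA)\<^sup>2\<close>.

  It remains to conclude \<open>f\<^sub>n \<rightarrow> 0\<close> from \<open>T\<^sup>k f\<^sub>n \<rightarrow> 0\<close> and \<open>(T - \<mu>)f\<^sub>n \<rightarrow> 0\<close>
  (\<open>converges_zero_of_power\<close>). Each factor \<open>T\<close> may be traded for a factor \<open>\<mu>\<close>, so the matter
  reduces to the fact that \<open>\<mu>f\<^sub>n \<rightarrow> 0\<close> forces \<open>f\<^sub>n \<rightarrow> 0\<close>, that is, to property \<open>(\<beta>)\<close> of the
  zero operator. Away from \<open>0\<close> one divides by \<open>\<mu>\<close>, and the maximum principle carries the
  estimate from a circle around \<open>0\<close> to its interior. The maximum principle for vector-valued
  functions follows from the scalar one by norming functionals, which the Hahn--Banach theorem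
  supplies.

  The argument works on every open set separately, so \<open>AC\<close> and \<open>BA\<close> have property \<open>(\<beta>)\<close> on the
  same open sets and their \<open>\<beta>\<close>-spectra agree.
\<close>

section \<open>Norming functionals\<close>

text \<open>
  A real functional dominated by the norm is handled through its graph: a subspace \<open>G\<close> of pairs
  with \<open>r \<le> norm x\<close> for \<open>(x, r) \<in> G\<close>. Such a subspace is single-valued, because \<open>(0, r) \<in> G\<close>
  and \<open>(0, -r) \<in> G\<close> force \<open>r = 0\<close>.
\<close>

definition dominated_graph :: "('a::real_normed_vector \<times> real) set \<Rightarrow> bool" where
  "dominated_graph G \<longleftrightarrow> subspace G \<and> (\<forall>(x, r)\<in>G. r \<le> norm x)"

lemma dominated_graph_unique:
  assumes "dominated_graph G" "(x, r) \<in> G" "(x, s) \<in> G"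
  shows "r = s"
proof -
  have sub: "subspace G" and dom: "\<And>x r. (x, r) \<in> G \<Longrightarrow> r \<le> norm x"
    using assms(1) unfolding dominated_graph_def by auto
  have "(0, r - s) \<in> G" "(0, s - r) \<in> G"
    using subspace_diff[OF sub assms(2,3)] subspace_diff[OF sub assms(3,2)] by auto
  from dom[OF this(1)] dom[OF this(2)] show ?thesis by simp
qed

text \<open>
  The value \<open>c\<close> at the new vector \<open>a\<close> has to lie above all \<open>r - norm (x - a)\<close> and below all
  \<open>norm (y + a) - s\<close>; the triangle inequality makes room for it.
\<close>

lemma dominated_graph_extend:
  fixes a :: "'a::real_normed_vector"
  assumes "dominated_graph G"
  obtains c where "dominated_graph (span (insert (a, c) G))"
proof -
  have sub: "subspace G" and dom: "\<And>x r. (x, r) \<in> G \<Longrightarrow> r \<le> norm x"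
    using assms unfolding dominated_graph_def by auto
  have room: "r - norm (x - a) \<le> norm (y + a) - s" if "(x, r) \<in> G" "(y, s) \<in> G" for x r y s
  proof -
    have "r + s \<le> norm (x + y)"
      using dom[of "x + y" "r + s"] subspace_add[OF sub that] by simp
    also have "\<dots> \<le> norm (x - a) + norm (y + a)"
      using norm_triangle_ineq[of "x - a" "y + a"] by simp
    finally show ?thesis by simp
  qed
  define L where "L = (\<lambda>(x, r). r - norm (x - a)) ` G"
  have zero: "(0, 0) \<in> G" using subspace_0[OF sub] by (simp add: zero_prod_def)
  have "L \<noteq> {}" using zero unfolding L_def by blast
  moreover have "bdd_above L"
    unfolding L_def bdd_above_def using room zero by fastforce
  ultimately have lower: "r - norm (x - a) \<le> Sup L" if "(x, r) \<in> G" for x r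
    using that by (intro cSup_upper) (auto simp: L_def image_iff)
  have upper: "Sup L \<le> norm (y + a) - s" if "(y, s) \<in> G" for y s
    using \<open>L \<noteq> {}\<close> by (rule cSup_least) (use room that in \<open>auto simp: L_def\<close>)
  have "w \<le> norm z" if zw: "(z, w) \<in> span (insert (a, Sup L) G)" for z w
  proof -
    from zw obtain k where "(z, w) - k *\<^sub>R (a, Sup L) \<in> span G"
      unfolding span_breakdown_eq by blast
    then have k: "(z - k *\<^sub>R a, w - k * Sup L) \<in> G"
      using sub by (simp add: span_eq_iff[THEN iffD2])
    consider "k = 0" | "k > 0" | "k < 0" by linarith
    then show ?thesis
    proof cases
      case 1
      then show ?thesis using k dom by simp
    next
      case 2
      have "((1/k) *\<^sub>R z - a, w / k - Sup L) \<in> G"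
        using subspace_scale[OF sub k, of "1/k"] 2 by (simp add: algebra_simps)
      from upper[OF this] have "w / k \<le> norm z / k" using 2 by simp
      then show ?thesis using 2 by (simp add: divide_le_cancel)
    next
      case 3
      have "((1/-k) *\<^sub>R z + a, w / -k + Sup L) \<in> G"
        using subspace_scale[OF sub k, of "1/-k"] 3 by (simp add: algebra_simps)
      from lower[OF this] have "w / -k \<le> norm z / -k" using 3 by simp
      then show ?thesis using 3 by (simp add: divide_le_cancel)
    qed
  qed
  then have "dominated_graph (span (insert (a, Sup L) G))"
    unfolding dominated_graph_def by (auto simp: subspace_span)
  then show thesis by (rule that)
qed

text \<open>
  Start from the graph of \<open>t a \<mapsto> t (norm a)\<close> and take a maximal dominated graph above it; by
  the extension step it is the graph of a functional on the whole space.
\<close>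

lemma real_norming_functional:
  fixes a :: "'a::real_normed_vector"
  obtains \<phi> :: "'a \<Rightarrow> real" where "linear \<phi>" "\<And>x. \<phi> x \<le> norm x" "\<phi> a = norm a"
proof -
  define \<A> where "\<A> = {G. dominated_graph G \<and> (a, norm a) \<in> G}"
  have "t * norm a \<le> \<bar>t\<bar> * norm a" for t
    by (intro mult_right_mono) auto
  then have "\<forall>(x, r)\<in>span {(a, norm a)}. r \<le> norm x"
    by (auto simp: span_singleton)
  then have "span {(a, norm a)} \<in> \<A>"
    unfolding \<A>_def dominated_graph_def by (simp add: subspace_span span_base)
  then have "\<A> \<noteq> {}" by blast
  moreover have "\<Union>\<C> \<in> \<A>" if ne: "\<C> \<noteq> {}" and ch: "subset.chain \<A> \<C>" for \<C>
  proof -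
    have mem: "dominated_graph G" "(a, norm a) \<in> G" if "G \<in> \<C>" for G
      using ch that unfolding subset.chain_def \<A>_def by auto
    have tot: "G \<subseteq> H \<or> H \<subseteq> G" if "G \<in> \<C>" "H \<in> \<C>" for G H
      using ch that unfolding subset_chain_def by blast
    have sub: "subspace G" if "G \<in> \<C>" for G
      using mem(1)[OF that] unfolding dominated_graph_def by blast
    have "subspace (\<Union>\<C>)"
    proof (rule subspaceI)
      show "0 \<in> \<Union>\<C>" using ne sub subspace_0 by blast
      show "c *\<^sub>R x \<in> \<Union>\<C>" if "x \<in> \<Union>\<C>" for c x
        using that sub subspace_scale by blast
      show "x + y \<in> \<Union>\<C>" if "x \<in> \<Union>\<C>" "y \<in> \<Union>\<C>" for x y
      proof -
        obtain G H where "x \<in> G" "G \<in> \<C>" "y \<in> H" "H \<in> \<C>" using \<open>x \<in> \<Union>\<C>\<close> \<open>y \<in> \<Union>\<C>\<close> by blast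
        then show ?thesis using tot[of G H] sub subspace_add by blast
      qed
    qed
    moreover have "\<forall>(x, r)\<in>\<Union>\<C>. r \<le> norm x"
      using mem(1) unfolding dominated_graph_def by blast
    ultimately show ?thesis
      using ne mem(2) unfolding \<A>_def dominated_graph_def by blast
  qed
  ultimately obtain M where M: "M \<in> \<A>" and max: "\<And>G. G \<in> \<A> \<Longrightarrow> M \<subseteq> G \<Longrightarrow> G = M"
    using subset_Zorn_nonempty[of \<A>] by blast
  have dg: "dominated_graph M" and aM: "(a, norm a) \<in> M" using M unfolding \<A>_def by auto
  have sub: "subspace M" and dom: "\<And>x r. (x, r) \<in> M \<Longrightarrow> r \<le> norm x"
    using dg unfolding dominated_graph_def by auto
  have "\<exists>r. (x, r) \<in> M" for x
  proof -
    obtain c where c: "dominated_graph (span (insert (x, c) M))"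
      using dominated_graph_extend[OF dg] .
    have "insert (x, c) M \<subseteq> span (insert (x, c) M)" by (rule span_superset)
    then show ?thesis
      using max[of "span (insert (x, c) M)"] c aM unfolding \<A>_def by blast
  qed
  then obtain \<phi> where \<phi>: "\<And>x. (x, \<phi> x) \<in> M" by metis
  have eq: "r = \<phi> x" if "(x, r) \<in> M" for x r
    using dominated_graph_unique[OF dg that \<phi>] .
  have "linear \<phi>"
  proof (rule linearI)
    show "\<phi> (x + y) = \<phi> x + \<phi> y" for x y
      using eq[of "x + y" "\<phi> x + \<phi> y"] subspace_add[OF sub \<phi> \<phi>, of x y] by simp
    show "\<phi> (c *\<^sub>R x) = c *\<^sub>R \<phi> x" for c x
      using eq[of "c *\<^sub>R x" "c *\<^sub>R \<phi> x"] subspace_scale[OF sub \<phi>, of c x] by simp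
  qed
  then show thesis using that dom[OF \<phi>] eq[OF aM] by metis
qed

lemma scaleC_Re_Im:
  fixes x :: "'a::complex_normed_vector"
  shows "c *\<^sub>C x = Re c *\<^sub>R x + Im c *\<^sub>R (\<i> *\<^sub>C x)"
proof -
  have "c *\<^sub>C x = (complex_of_real (Re c) + complex_of_real (Im c) * \<i>) *\<^sub>C x"
    by (metis complex_eq mult.commute)
  also have "\<dots> = Re c *\<^sub>R x + Im c *\<^sub>R (\<i> *\<^sub>C x)"
    by (simp only: scaleC_add_left flip: scaleC_scaleC)
      (simp only: scaleC_complex_of_real)
  finally show ?thesis .
qed

text \<open>
  A real functional \<open>\<phi>\<close> is the real part of the complex functional \<open>x \<mapsto> \<phi> x - \<i> \<phi> (\<i> x)\<close>. Only
  its real part is compared with the norm: this is the form in which the maximum principle for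
  real parts of holomorphic functions can be used.
\<close>

lemma complex_norming_functional:
  fixes a :: "'a::complex_normed_vector"
  obtains \<psi> :: "'a \<Rightarrow> complex"
  where "bounded_clinear \<psi>" "\<And>x. Re (\<psi> x) \<le> norm x" "Re (\<psi> a) = norm a"
proof -
  obtain \<phi> :: "'a \<Rightarrow> real" where lin: "linear \<phi>" and le: "\<And>x. \<phi> x \<le> norm x" and a: "\<phi> a = norm a"
    using real_norming_functional[of a] by blast
  have abs: "\<bar>\<phi> x\<bar> \<le> norm x" for x
    using le[of x] le[of "- x"] linear_neg[OF lin, of x] by simp
  define \<psi> where "\<psi> = (\<lambda>x. Complex (\<phi> x) (- \<phi> (\<i> *\<^sub>C x)))"
  have clin: "\<psi> (c *\<^sub>C x) = c * \<psi> x" for c x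
  proof -
    have 1: "\<phi> (c *\<^sub>C x) = Re c * \<phi> x + Im c * \<phi> (\<i> *\<^sub>C x)" for c x
      by (subst scaleC_Re_Im) (simp add: linear_add[OF lin] linear_scale[OF lin])
    show ?thesis
      using 1[of c x] 1[of "\<i> * c" x]
      by (simp add: \<psi>_def complex_eq_iff scaleC_scaleC)
  qed
  have "bounded_linear \<psi>"
  proof (rule bounded_linear_intro)
    show "\<psi> (x + y) = \<psi> x + \<psi> y" for x y
      by (simp add: \<psi>_def linear_add[OF lin] scaleC_add_right complex_eq_iff)
    show "\<psi> (r *\<^sub>R x) = r *\<^sub>R \<psi> x" for r x
      using clin[of "complex_of_real r" x] by (simp add: scaleC_complex_of_real scaleR_conv_of_real)
    show "norm (\<psi> x) \<le> norm x * 2" for x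
      using cmod_le[of "\<psi> x"] abs[of x] abs[of "\<i> *\<^sub>C x"]
      by (simp add: \<psi>_def norm_scaleC)
  qed
  then have "bounded_clinear \<psi>" unfolding bounded_clinear_def scaleC_complex_def using clin by blast
  then show thesis using le a by (intro that) (auto simp: \<psi>_def)
qed

section \<open>The space of analytic functions\<close>

lemma bounded_clinear_compose:
  "bounded_clinear S \<Longrightarrow> bounded_clinear T \<Longrightarrow> bounded_clinear (S \<circ> T)"
  unfolding bounded_clinear_def by (auto simp: o_def intro: bounded_linear_compose)

lemma analytic_space_bounded_clinear:
  assumes "bounded_clinear T" "f \<in> analytic_space V"
  shows "(\<lambda>\<mu>. T (f \<mu>)) \<in> analytic_space V"
  unfolding analytic_space_def
proof safe
  fix z assume "z \<in> V"
  then obtain D where "(f has_derivative (\<lambda>h. h *\<^sub>C D)) (at z)"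
    using assms(2) unfolding analytic_space_def by blast
  then have "((\<lambda>\<mu>. T (f \<mu>)) has_derivative (\<lambda>h. T (h *\<^sub>C D))) (at z)"
    using assms(1) bounded_linear.has_derivative unfolding bounded_clinear_def by metis
  then have "((\<lambda>\<mu>. T (f \<mu>)) has_derivative (\<lambda>h. h *\<^sub>C T D)) (at z)"
    using assms(1) unfolding bounded_clinear_def by simp
  then show "\<exists>D. ((\<lambda>\<mu>. T (f \<mu>)) has_derivative (\<lambda>h. h *\<^sub>C D)) (at z)" by blast
qed

lemma converges_zero_bounded_clinear:
  assumes "bounded_clinear T" "converges_in_analytic_space V f (\<lambda>\<mu>. 0)"
  shows "converges_in_analytic_space V (\<lambda>n \<mu>. T (f n \<mu>)) (\<lambda>\<mu>. 0)"
proof -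
  have T: "bounded_linear T" using assms(1) unfolding bounded_clinear_def by blast
  have "uniform_limit K (\<lambda>n \<mu>. T (f n \<mu>)) (\<lambda>\<mu>. T 0) sequentially"
    if "compact K" "K \<subseteq> V" for K
    using assms(2) that unfolding converges_in_analytic_space_def
    by (intro bounded_linear.uniform_limit[OF T]) auto
  then show ?thesis
    by (simp add: converges_in_analytic_space_def linear_0[OF bounded_linear.linear[OF T]])
qed

text \<open>
  Compose \<open>f\<close> with a functional \<open>\<psi>\<close> that norms the single vector \<open>f w\<close>. Then \<open>Re (\<psi> (f z))\<close> is at
  most \<open>norm (f z)\<close> everywhere, with equality at \<open>w\<close>, and the scalar principle applies.
\<close>

lemma maximum_modulus_analytic_space:
  fixes f :: "complex \<Rightarrow> 'a::complex_normed_vector"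
  assumes f: "f \<in> analytic_space V" and V: "open V" "cball a r \<subseteq> V" and r: "r > 0"
    and bound: "\<And>z. z \<in> sphere a r \<Longrightarrow> norm (f z) \<le> M"
    and w: "w \<in> cball a r"
  shows "norm (f w) \<le> M"
proof -
  obtain \<psi> :: "'a \<Rightarrow> complex" where \<psi>: "bounded_clinear \<psi>" "\<And>x. Re (\<psi> x) \<le> norm x"
      "Re (\<psi> (f w)) = norm (f w)"
    using complex_norming_functional[of "f w"] by blast
  have hol: "(\<lambda>\<mu>. \<psi> (f \<mu>)) holomorphic_on V"
    using analytic_space_bounded_clinear[OF \<psi>(1) f] analytic_space_complex_iff[OF V(1)] by blast
  have "Re (\<psi> (f w)) \<le> M"
  proof (rule maximum_real_frontier[where S = "cball a r" and f = "\<lambda>\<mu>. \<psi> (f \<mu>)"])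
    show "(\<lambda>\<mu>. \<psi> (f \<mu>)) holomorphic_on interior (cball a r)"
      using hol V(2) interior_subset by (meson holomorphic_on_subset order_trans)
    show "continuous_on (closure (cball a r)) (\<lambda>\<mu>. \<psi> (f \<mu>))"
      using holomorphic_on_imp_continuous_on[OF hol] V(2) by (simp add: continuous_on_subset)
    show "Re (\<psi> (f z)) \<le> M" if "z \<in> frontier (cball a r)" for z
      using that \<psi>(2)[of "f z"] bound[of z] by (simp add: frontier_cball)
  qed (use w in auto)
  then show ?thesis using \<psi>(3) by simp
qed

section \<open>Property \<open>(\<beta>)\<close> under intertwining\<close>

text \<open>
  For the zero operator, property \<open>(\<beta>)\<close> says that \<open>\<mu>f\<^sub>n \<rightarrow> 0\<close> implies \<open>f\<^sub>n \<rightarrow> 0\<close>. The factor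
  \<open>\<mu>\<close> is bounded below off a disc around \<open>0\<close>, and the values in the disc are bounded by those on
  its boundary circle.
\<close>

lemma bishop_beta_on_zero_operator:
  "bishop_beta_on (\<lambda>x::'a::complex_normed_vector. 0) U"
  unfolding bishop_beta_on_def
proof (intro allI impI, elim conjE)
  fix V and f :: "nat \<Rightarrow> complex \<Rightarrow> 'a"
  assume V: "open V" and f: "\<forall>n. f n \<in> analytic_space V"
    and lim: "converges_in_analytic_space V (\<lambda>n \<mu>. 0 - \<mu> *\<^sub>C f n \<mu>) (\<lambda>\<mu>. 0)"
  show "converges_in_analytic_space V f (\<lambda>\<mu>. 0)"
    unfolding converges_in_analytic_space_def
  proof (intro allI impI, elim conjE)
    fix K assume K: "compact K" "K \<subseteq> V"
    (* If 0 lies outside V, the disc only has to avoid K. *)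
    have "\<exists>r>0. if 0 \<in> V then cball 0 r \<subseteq> V else ball 0 r \<inter> K = {}"
    proof (cases "0 \<in> V")
      case True
      then show ?thesis using V open_contains_cball by auto
    next
      case False
      then have "0 \<in> - K" "open (- K)" using K compact_imp_closed by auto
      then obtain r where "r > 0" "ball 0 r \<subseteq> - K" using open_contains_ball by metis
      then show ?thesis using False by auto
    qed
    then obtain r where r: "r > 0" "0 \<in> V \<Longrightarrow> cball 0 r \<subseteq> V" "0 \<notin> V \<Longrightarrow> ball 0 r \<inter> K = {}"
      by metis
    define K' where "K' = K \<union> (if 0 \<in> V then sphere 0 r else {})"
    have "sphere 0 r \<subseteq> V" if "0 \<in> V"
      using sphere_cball r(2)[OF that] by (rule order_trans)
    then have K': "compact K'" "K' \<subseteq> V"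
      using K unfolding K'_def by auto
    show "uniform_limit K f (\<lambda>\<mu>. 0) sequentially"
      unfolding uniform_limit_iff
    proof (intro allI impI)
      fix e :: real assume e: "e > 0"
      have "e / 2 * r > 0" using e r(1) by simp
      then have "\<forall>\<^sub>F n in sequentially. \<forall>\<mu>\<in>K'. dist (0 - \<mu> *\<^sub>C f n \<mu>) 0 < e / 2 * r"
        using lim K' unfolding converges_in_analytic_space_def uniform_limit_iff by blast
      then show "\<forall>\<^sub>F n in sequentially. \<forall>\<mu>\<in>K. dist (f n \<mu>) 0 < e"
      proof eventually_elim
        case (elim n)
        have off: "norm (f n \<mu>) \<le> e / 2" if "\<mu> \<in> K'" "r \<le> norm \<mu>" for \<mu>
        proof -
          have "r * norm (f n \<mu>) \<le> norm \<mu> * norm (f n \<mu>)"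
            using that by (intro mult_right_mono) auto
          also have "\<dots> < e / 2 * r" using elim that by (simp add: norm_scaleC)
          finally show ?thesis using r(1) by (simp add: mult.commute)
        qed
        have "norm (f n \<mu>) \<le> e / 2" if \<mu>: "\<mu> \<in> K" for \<mu>
        proof (cases "r \<le> norm \<mu>")
          case True
          then show ?thesis using off \<mu> unfolding K'_def by blast
        next
          case False
          then have "\<mu> \<in> ball 0 r" by simp
          then have "0 \<in> V" using r(3) \<mu> by blast
          show ?thesis
          proof (rule maximum_modulus_analytic_space[OF _ V r(2)[OF \<open>0 \<in> V\<close>] r(1)])
            show "norm (f n z) \<le> e / 2" if "z \<in> sphere 0 r" for z
              using that \<open>0 \<in> V\<close> by (intro off) (auto simp: K'_def)
          qed (use f False in auto)
        qed
        then show ?case using e by fastforce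
      qed
    qed
  qed
qed

text \<open>
  By induction the claim holds for the functions \<open>T f\<^sub>n\<close>, so \<open>T f\<^sub>n \<rightarrow> 0\<close>; subtracting
  \<open>(T - \<mu>)f\<^sub>n\<close> leaves \<open>\<mu>f\<^sub>n \<rightarrow> 0\<close>.
\<close>

lemma converges_zero_of_power:
  fixes T :: "'a::complex_normed_vector \<Rightarrow> 'a"
  assumes T: "bounded_clinear T" and V: "open V"
    and f: "\<And>n. f n \<in> analytic_space V"
    and lim: "converges_in_analytic_space V (\<lambda>n \<mu>. T (f n \<mu>) - \<mu> *\<^sub>C f n \<mu>) (\<lambda>\<mu>. 0)"
    and pow: "converges_in_analytic_space V (\<lambda>n \<mu>. (T ^^ k) (f n \<mu>)) (\<lambda>\<mu>. 0)"
  shows "converges_in_analytic_space V f (\<lambda>\<mu>. 0)"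
  using f lim pow
proof (induction k arbitrary: f)
  case 0
  then show ?case by simp
next
  case (Suc k)
  have Tsub: "T (T (f n \<mu>) - \<mu> *\<^sub>C f n \<mu>) = T (T (f n \<mu>)) - \<mu> *\<^sub>C T (f n \<mu>)" for n \<mu>
    using T unfolding bounded_clinear_def
    by (simp add: linear_diff bounded_linear.linear)
  have Tf: "converges_in_analytic_space V (\<lambda>n \<mu>. T (f n \<mu>)) (\<lambda>\<mu>. 0)"
  proof (rule Suc.IH)
    show "(\<lambda>\<mu>. T (f n \<mu>)) \<in> analytic_space V" for n
      using analytic_space_bounded_clinear[OF T] Suc.prems(1) by blast
    show "converges_in_analytic_space V
        (\<lambda>n \<mu>. T (T (f n \<mu>)) - \<mu> *\<^sub>C T (f n \<mu>)) (\<lambda>\<mu>. 0)"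
      using converges_zero_bounded_clinear[OF T Suc.prems(2)] by (simp add: Tsub)
    show "converges_in_analytic_space V (\<lambda>n \<mu>. (T ^^ k) (T (f n \<mu>))) (\<lambda>\<mu>. 0)"
      using Suc.prems(3) by (simp add: funpow_swap1)
  qed
  have "converges_in_analytic_space V (\<lambda>n \<mu>. 0 - \<mu> *\<^sub>C f n \<mu>) (\<lambda>\<mu>. 0)"
    unfolding converges_in_analytic_space_def
  proof (intro allI impI)
    fix K assume K: "compact K \<and> K \<subseteq> V"
    have "uniform_limit K (\<lambda>n \<mu>. (T (f n \<mu>) - \<mu> *\<^sub>C f n \<mu>) - T (f n \<mu>)) (\<lambda>\<mu>. 0 - 0) sequentially"
      using Suc.prems(2) Tf K unfolding converges_in_analytic_space_def
      by (intro uniform_limit_minus) auto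
    then show "uniform_limit K (\<lambda>n \<mu>. 0 - \<mu> *\<^sub>C f n \<mu>) (\<lambda>\<mu>. 0) sequentially" by simp
  qed
  then show ?case
    using bishop_beta_on_zero_operator[of V] V Suc.prems(1) unfolding bishop_beta_on_def by blast
qed

text \<open>
  Property \<open>(\<beta>)\<close> passes from \<open>S\<close> to \<open>T\<close> along \<open>R\<close>, because \<open>R\<close> turns \<open>(T - \<mu>)f\<^sub>n\<close> into
  \<open>(S - \<mu>)R f\<^sub>n\<close>. The operator \<open>R\<close> may have a kernel; \<open>Q\<close> recovers \<open>T\<^sup>k f\<^sub>n\<close> from \<open>R f\<^sub>n\<close>, which
  is enough by the preceding lemma.
\<close>

lemma bishop_beta_on_intertwined:
  fixes S :: "'x::complex_normed_vector \<Rightarrow> 'x" and T :: "'y::complex_normed_vector \<Rightarrow> 'y"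
  assumes T: "bounded_clinear T" and R: "bounded_clinear R" and Q: "bounded_clinear Q"
    and SR: "\<And>y. S (R y) = R (T y)" and QR: "\<And>y. Q (R y) = (T ^^ k) y"
    and beta: "bishop_beta_on S U"
  shows "bishop_beta_on T U"
  unfolding bishop_beta_on_def
proof (intro allI impI, elim conjE)
  fix V f
  assume V: "open V" "V \<subseteq> U" and f: "\<forall>n. f n \<in> analytic_space V"
    and lim: "converges_in_analytic_space V (\<lambda>n \<mu>. T (f n \<mu>) - \<mu> *\<^sub>C f n \<mu>) (\<lambda>\<mu>. 0)"
  have "R (T (f n \<mu>) - \<mu> *\<^sub>C f n \<mu>) = S (R (f n \<mu>)) - \<mu> *\<^sub>C R (f n \<mu>)" for n \<mu>
    using R unfolding bounded_clinear_def
    by (simp add: SR linear_diff bounded_linear.linear)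
  then have "converges_in_analytic_space V (\<lambda>n \<mu>. S (R (f n \<mu>)) - \<mu> *\<^sub>C R (f n \<mu>)) (\<lambda>\<mu>. 0)"
    using converges_zero_bounded_clinear[OF R lim] by simp
  moreover have "\<forall>n. (\<lambda>\<mu>. R (f n \<mu>)) \<in> analytic_space V"
    using f analytic_space_bounded_clinear[OF R] by blast
  ultimately have "converges_in_analytic_space V (\<lambda>n \<mu>. R (f n \<mu>)) (\<lambda>\<mu>. 0)"
    using beta[unfolded bishop_beta_on_def, rule_format, of V "\<lambda>n \<mu>. R (f n \<mu>)"] V by blast
  from converges_zero_bounded_clinear[OF Q this]
  have "converges_in_analytic_space V (\<lambda>n \<mu>. (T ^^ k) (f n \<mu>)) (\<lambda>\<mu>. 0)"
    by (simp add: QR)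
  then show "converges_in_analytic_space V f (\<lambda>\<mu>. 0)"
    using converges_zero_of_power[OF T V(1) _ lim] f by blast
qed

theorem theorem2p2:
  fixes A :: "'x::complex_banach \<Rightarrow> 'y::complex_banach"
    and B C :: "'y \<Rightarrow> 'x"
  assumes "bounded_clinear A" and "bounded_clinear B" and "bounded_clinear C"
    and "A \<circ> (B \<circ> A) ^^ 2 = A \<circ> B \<circ> A \<circ> C \<circ> A"
    and "A \<circ> B \<circ> A \<circ> C \<circ> A = A \<circ> C \<circ> A \<circ> B \<circ> A"
    and "A \<circ> C \<circ> A \<circ> B \<circ> A = (A \<circ> C) ^^ 2 \<circ> A"
  shows "sigma_beta (A \<circ> C) = sigma_beta (B \<circ> A) \<and>
    (bishop_beta (A \<circ> C) \<longleftrightarrow> bishop_beta (B \<circ> A))"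
proof -
  have 1: "A (B (A (C (A x)))) = A (B (A (B (A x))))" for x
    using fun_cong[OF assms(4), of x] by (simp add: numeral_2_eq_2)
  have 2: "A (C (A (B (A x)))) = A (B (A (B (A x))))" for x
    using fun_cong[OF assms(5), of x] 1[of x] by simp
  have 3: "A (C (A (C (A x)))) = A (B (A (B (A x))))" for x
    using fun_cong[OF assms(6), of x] 2[of x] by (simp add: numeral_2_eq_2)
  have BABAC: "bounded_clinear (\<lambda>y. B (A (B (A (C y)))))"
    using bounded_clinear_compose[OF assms(2) bounded_clinear_compose[OF assms(1)
        bounded_clinear_compose[OF assms(2) bounded_clinear_compose[OF assms(1,3)]]]]
    by (simp add: o_def)
  have ABA: "bounded_clinear (\<lambda>x. A (B (A x)))"
    using bounded_clinear_compose[OF assms(1) bounded_clinear_compose[OF assms(2,1)]]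
    by (simp add: o_def)
  have "bishop_beta_on (A \<circ> C) U \<longleftrightarrow> bishop_beta_on (B \<circ> A) U" for U
  proof
    assume beta: "bishop_beta_on (A \<circ> C) U"
    show "bishop_beta_on (B \<circ> A) U"
      by (rule bishop_beta_on_intertwined[OF bounded_clinear_compose[OF assms(2,1)] ABA assms(2)
            _ _ beta, where k = 2])
        (simp_all add: 2 numeral_2_eq_2)
  next
    assume beta: "bishop_beta_on (B \<circ> A) U"
    show "bishop_beta_on (A \<circ> C) U"
      by (rule bishop_beta_on_intertwined[OF bounded_clinear_compose[OF assms(1,3)] BABAC assms(1)
            _ _ beta, where k = 3])
        (simp_all add: 1 3 numeral_3_eq_3)
  qed
  then have "sigma_beta (A \<circ> C) = sigma_beta (B \<circ> A)"
    unfolding sigma_beta_def rho_beta_eq_Union by simp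
  then show ?thesis unfolding bishop_beta_def by simp
qed

end
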